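(* Let $f_1,f_2\in S$ be two monic polynomials of degree $n$ with companion matrices $C_{f_1},C_{f_2}$. Suppose that $B\in M_n(R)$ is a monomial matrix and $C_{f_1}B=\sigma(B)C_{f_2}+\delta(B)$. Then there is a one-to-one correspondence between the set of right $(\sigma,\delta)$-polycyclic codes in $S/Sf_1$ and the set of right $(\sigma,\delta)$-polycyclic codes in $S/Sf_2$ such that corresponding codes are Hamming isometrically equivalent.
   Context: $R$ is a finite ring with $1\neq 0$ (not necessarily commutative), $\sigma$ is a ring endomorphism of $R$ with $\sigma(1)=1$, and $\delta:R\to R$ is additive with $\delta(ab)=\sigma(a)\delta(b)+\delta(a)b$. $S=R[x,\sigma,\delta]$ is the Ore extension: polynomials with coefficients on the left, usual addition, multiplication determined by $xa=\sigma(a)x+\delta(a)$ and $x^rx^s=x^{r+s}$. For a monic $f=-f_0-f_1x-\cdots-f_{n-1}x^{n-1}+x^n$, the companion matrix $C_f\in M_n(R)$ has $i$-th row equal to the $(i+1)$-st standard basis vector for $1\le i\le n-1$ and last row $(f_0,\ldots,f_{n-1})$. $\sigma(B),\delta(B)$ are obtained by applying $\sigma,\delta$ to every entry. A monomial matrix is one with exactly one nonzero entry in each row and each column, these entries being units. A right $(\sigma,\delta)$-polycyclic code in $S/Sf$ is a left $R$-submodule $C\subseteq R^n$ such that for every $g=(g_0,\ldots,g_{n-1})\in C$, $(0,\sigma(g_0),\ldots,\sigma(g_{n-2}))+\sigma(g_{n-1})(f_0,\ldots,f_{n-1})+\delta(g)\in C$ (equivalently, identifying $(g_0,\ldots,g_{n-1})$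 with $\sum g_ix^i$, a left $S$-submodule of $S/Sf$). The Hamming weight of a vector is the number of its nonzero coordinates. Two codes $C_1,C_2\subseteq R^n$ are Hamming isometrically equivalent if there is a (left $R$-linear) isomorphism $\psi:C_1\to C_2$ preserving the Hamming weight of every codeword. *)

theory Defs
  imports
    "Jordan_Normal_Form.Matrix"
    "HOL-Computational_Algebra.Polynomial"
begin

text \<open>
  The ring \<open>R\<close> is a type of class \<open>ring_1\<close>, not assumed commutative, and \<open>R\<^sup>n\<close> is
  \<open>carrier_vec n\<close>. The underlying set of the Ore extension \<open>S = R[x, \<sigma>, \<delta>]\<close> is \<open>'a poly\<close>,
  with coefficients read on the left of the powers of \<open>x\<close>; only its additive structure is used.
  Indices start at \<open>0\<close>.
\<close>

definition skew_derivation :: "('a::ring_1 \<Rightarrow> 'a) \<Rightarrow> ('a \<Rightarrow> 'a) \<Rightarrow> bool" where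
  "skew_derivation \<sigma> \<delta> \<longleftrightarrow>
     (\<forall>a b. \<delta> (a + b) = \<delta> a + \<delta> b) \<and>
     (\<forall>a b. \<delta> (a * b) = \<sigma> a * \<delta> b + \<delta> a * b)"

text \<open>
  A monic polynomial of degree \<open>n\<close> is written \<open>x\<^sup>n - f\<^sub>n\<^sub>-\<^sub>1 x\<^sup>n\<^sup>-\<^sup>1 - \<dots> - f\<^sub>0\<close>, so the vector
  \<open>(f\<^sub>0, \<dots>, f\<^sub>n\<^sub>-\<^sub>1)\<close> consists of the negated coefficients.
\<close>

definition tail_vec :: "'a::ring_1 poly \<Rightarrow> 'a vec" where
  "tail_vec f = vec (degree f) (\<lambda>i. - coeff f i)"

definition companion :: "'a::ring_1 poly \<Rightarrow> 'a mat" where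
  "companion f = mat_of_rows (degree f)
     (map (\<lambda>i. if Suc i < degree f then unit_vec (degree f) (Suc i) else tail_vec f)
       [0..<degree f])"

text \<open>\<open>R\<close> is not commutative, so a unit is required to have a two-sided inverse.\<close>

definition ring_unit :: "'a::ring_1 \<Rightarrow> bool" where
  "ring_unit a \<longleftrightarrow> (\<exists>b. a * b = 1 \<and> b * a = 1)"

definition monomial_mat :: "nat \<Rightarrow> 'a::ring_1 mat \<Rightarrow> bool" where
  "monomial_mat n B \<longleftrightarrow>
     B \<in> carrier_mat n n \<and>
     (\<forall>i<n. \<exists>!j. j < n \<and> B $$ (i, j) \<noteq> 0) \<and>
     (\<forall>j<n. \<exists>!i. i < n \<and> B $$ (i, j) \<noteq> 0) \<and>
     (\<forall>i<n. \<forall>j<n. B $$ (i, j) \<noteq> 0 \<longrightarrow> ring_unit (B $$ (i, j)))"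

definition left_submodule :: "nat \<Rightarrow> 'a::ring_1 vec set \<Rightarrow> bool" where
  "left_submodule n C \<longleftrightarrow>
     C \<subseteq> carrier_vec n \<and> 0\<^sub>v n \<in> C \<and>
     (\<forall>u\<in>C. \<forall>v\<in>C. u + v \<in> C) \<and>
     (\<forall>a. \<forall>v\<in>C. a \<cdot>\<^sub>v v \<in> C)"

text \<open>
  \<open>shift_vec \<sigma> g\<close> is \<open>(0, \<sigma> g\<^sub>0, \<dots>, \<sigma> g\<^sub>n\<^sub>-\<^sub>2)\<close>. The map \<open>polycyclic_map\<close> is left multiplication
  by \<open>x\<close> in \<open>S/Sf\<close>, expressed in the basis \<open>1, x, \<dots>, x\<^sup>n\<^sup>-\<^sup>1\<close>. For \<open>n = 0\<close> every vector is empty,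
  so the out-of-range entry \<open>g $ (n - 1)\<close> has no effect.
\<close>

definition shift_vec :: "('a::ring_1 \<Rightarrow> 'a) \<Rightarrow> 'a vec \<Rightarrow> 'a vec" where
  "shift_vec \<sigma> g = vec (dim_vec g) (\<lambda>i. if i = 0 then 0 else \<sigma> (g $ (i - 1)))"

definition polycyclic_map ::
  "('a::ring_1 \<Rightarrow> 'a) \<Rightarrow> ('a \<Rightarrow> 'a) \<Rightarrow> 'a poly \<Rightarrow> 'a vec \<Rightarrow> 'a vec" where
  "polycyclic_map \<sigma> \<delta> f g =
     shift_vec \<sigma> g + \<sigma> (g $ (degree f - 1)) \<cdot>\<^sub>v tail_vec f + map_vec \<delta> g"

definition polycyclic_codes ::
  "('a::ring_1 \<Rightarrow> 'a) \<Rightarrow> ('a \<Rightarrow> 'a) \<Rightarrow> 'a poly \<Rightarrow> 'a vec set set" where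
  "polycyclic_codes \<sigma> \<delta> f =
     {C. left_submodule (degree f) C \<and> (\<forall>g\<in>C. polycyclic_map \<sigma> \<delta> f g \<in> C)}"

definition hamming_weight :: "'a::zero vec \<Rightarrow> nat" where
  "hamming_weight v = card {i. i < dim_vec v \<and> v $ i \<noteq> 0}"

definition hamming_isom_equiv :: "'a::ring_1 vec set \<Rightarrow> 'a vec set \<Rightarrow> bool" where
  "hamming_isom_equiv C1 C2 \<longleftrightarrow>
     (\<exists>\<psi>. bij_betw \<psi> C1 C2 \<and>
          (\<forall>u\<in>C1. \<forall>v\<in>C1. \<psi> (u + v) = \<psi> u + \<psi> v) \<and>
          (\<forall>a. \<forall>v\<in>C1. \<psi> (a \<cdot>\<^sub>v v) = a \<cdot>\<^sub>v \<psi> v) \<and>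
          (\<forall>v\<in>C1. hamming_weight (\<psi> v) = hamming_weight v))"

end

theory Submission
  imports Defs
begin

text \<open>
  Write \<open>T\<^sub>f g = \<sigma>(g) C\<^sub>f + \<delta>(g)\<close> for row vectors \<open>g\<close>; this is the polycyclic map of \<open>f\<close>. The
  hypothesis on \<open>B\<close> and the product rule for \<open>\<delta>\<close> give \<open>T\<^bsub>f1\<^esub>(g) B = T\<^bsub>f2\<^esub>(g B)\<close>, so the
  left linear bijection \<open>g \<mapsto> g B\<close> carries right polycyclic codes to right polycyclic codes.
  It preserves Hamming weights because \<open>B\<close> permutes the coordinates up to units.
\<close>

text \<open>Coordinates stand to the left of the matrix entries, which makes the operation left
  linear. Over a noncommutative ring, letting the transposed matrix act on a column by
  \<open>*\<^sub>v\<close> would reverse the factors in each product and give a different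
  map.\<close>

definition vec_mat_mult :: "'a::semiring_0 vec \<Rightarrow> 'a mat \<Rightarrow> 'a vec" (infixl "\<^sub>v*" 70) where
  "v \<^sub>v* A = vec (dim_col A) (\<lambda>j. \<Sum>i<dim_row A. v $ i * A $$ (i, j))"

lemma dim_vec_mat_mult [simp]: "dim_vec (v \<^sub>v* A) = dim_col A"
  by (simp add: vec_mat_mult_def)

lemma index_vec_mat_mult [simp]:
  "j < dim_col A \<Longrightarrow> (v \<^sub>v* A) $ j = (\<Sum>i<dim_row A. v $ i * A $$ (i, j))"
  by (simp add: vec_mat_mult_def)

lemma vec_mat_mult_carrier [simp]: "A \<in> carrier_mat m n \<Longrightarrow> v \<^sub>v* A \<in> carrier_vec n"
  by (auto intro: carrier_vecI)

lemma vec_mat_mult_add_left: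
  assumes "A \<in> carrier_mat m n" "u \<in> carrier_vec m" "v \<in> carrier_vec m"
  shows "(u + v) \<^sub>v* A = u \<^sub>v* A + v \<^sub>v* A"
  using assms by (intro eq_vecI) (auto simp: sum.distrib distrib_right)

lemma vec_mat_mult_add_right:
  assumes "A \<in> carrier_mat m n" "B \<in> carrier_mat m n"
  shows "v \<^sub>v* (A + B) = v \<^sub>v* A + v \<^sub>v* B"
  using assms by (intro eq_vecI) (auto simp: sum.distrib distrib_left)

lemma vec_mat_mult_smult:
  assumes "A \<in> carrier_mat m n" "v \<in> carrier_vec m"
  shows "(a \<cdot>\<^sub>v v) \<^sub>v* A = a \<cdot>\<^sub>v (v \<^sub>v* A)"
  using assms by (intro eq_vecI) (auto simp: sum_distrib_left mult.assoc)

lemma vec_mat_mult_zero: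
  assumes "A \<in> carrier_mat m n"
  shows "0\<^sub>v m \<^sub>v* A = 0\<^sub>v n"
  using assms by (intro eq_vecI) auto

lemma vec_mat_mult_assoc:
  assumes "A \<in> carrier_mat m n" "B \<in> carrier_mat n p"
  shows "v \<^sub>v* (A * B) = (v \<^sub>v* A) \<^sub>v* B"
proof (rule eq_vecI)
  fix j assume "j < dim_vec ((v \<^sub>v* A) \<^sub>v* B)"
  then have j: "j < p" using assms by simp
  have "(v \<^sub>v* (A * B)) $ j = (\<Sum>i<m. v $ i * (\<Sum>k<n. A $$ (i, k) * B $$ (k, j)))"
    using assms j by (auto simp: scalar_prod_def lessThan_atLeast0 intro!: sum.cong)
  also have "\<dots> = (\<Sum>k<n. \<Sum>i<m. v $ i * A $$ (i, k) * B $$ (k, j))"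
    by (subst sum.swap) (simp add: sum_distrib_left mult.assoc)
  also have "\<dots> = ((v \<^sub>v* A) \<^sub>v* B) $ j"
    using assms j by (auto simp: sum_distrib_right intro!: sum.cong)
  finally show "(v \<^sub>v* (A * B)) $ j = ((v \<^sub>v* A) \<^sub>v* B) $ j" .
qed (use assms in simp)

lemma map_vec_vec_mat_mult_hom:
  fixes \<sigma> :: "'a::ring_1 \<Rightarrow> 'a"
  assumes "Ring_Hom.ring_hom \<sigma>" "A \<in> carrier_mat m n" "v \<in> carrier_vec m"
  shows "map_vec \<sigma> (v \<^sub>v* A) = map_vec \<sigma> v \<^sub>v* map_mat \<sigma> A"
proof -
  interpret Ring_Hom.ring_hom \<sigma> by fact
  show ?thesis
    using assms(2,3) by (intro eq_vecI) (auto simp: hom_sum hom_mult)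
qed

lemma skew_derivation_sum:
  assumes "skew_derivation \<sigma> \<delta>"
  shows "\<delta> (\<Sum>i\<in>I. g i) = (\<Sum>i\<in>I. \<delta> (g i))"
proof -
  have add: "\<delta> (a + b) = \<delta> a + \<delta> b" for a b
    using assms by (simp add: skew_derivation_def)
  \<comment> \<open>This settles the empty index set and also the infinite one, over which a sum is
    0 by default.\<close>
  have "\<delta> 0 = 0" using add[of 0 0] by simp
  then show ?thesis
    by (induction I rule: infinite_finite_induct) (simp_all add: add)
qed

text \<open>The product rule is applied to each summand \<open>v $ i * A $$ (i, j)\<close>. It puts
  \<sigma> on the vector when \<delta> falls on the matrix, which is where the term
  \<open>map_mat \<delta> B\<close> in the condition on \<open>B\<close> comes from.\<close>

lemma map_vec_vec_mat_mult_skew_derivation: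
  assumes "skew_derivation \<sigma> \<delta>" "A \<in> carrier_mat m n" "v \<in> carrier_vec m"
  shows "map_vec \<delta> (v \<^sub>v* A) = map_vec \<sigma> v \<^sub>v* map_mat \<delta> A + map_vec \<delta> v \<^sub>v* A"
proof -
  have "\<delta> (a * b) = \<sigma> a * \<delta> b + \<delta> a * b" for a b
    using assms(1) by (simp add: skew_derivation_def)
  then show ?thesis
    using assms(2,3)
    by (intro eq_vecI) (auto simp: skew_derivation_sum[OF assms(1)] sum.distrib)
qed

lemma companion_carrier [simp]: "companion f \<in> carrier_mat (degree f) (degree f)"
  by (simp add: companion_def mat_of_rows_def)

lemma dim_companion [simp]: "dim_row (companion f) = degree f" "dim_col (companion f) = degree f"
  using carrier_matD[OF companion_carrier[of f]] by blast+

lemma index_companion: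
  assumes "i < degree f" "j < degree f"
  shows "companion f $$ (i, j) =
    (if Suc i < degree f then if j = Suc i then 1 else 0 else - coeff f j)"
  using assms by (simp add: companion_def mat_of_rows_def tail_vec_def unit_vec_def)

text \<open>Every row of the companion matrix but the last moves coordinate \<open>i\<close> to
  position \<open>i + 1\<close>, which produces the shift; the last row contributes the tail of
  \<open>f\<close>, scaled by the last coordinate.\<close>

lemma polycyclic_map_eq:
  assumes "g \<in> carrier_vec (degree f)"
  shows "polycyclic_map \<sigma> \<delta> f g = map_vec \<sigma> g \<^sub>v* companion f + map_vec \<delta> g"
proof (rule eq_vecI)
  let ?n = "degree f"
  fix j assume "j < dim_vec (map_vec \<sigma> g \<^sub>v* companion f + map_vec \<delta> g)"
  then have j: "j < ?n" using assms by simp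
  \<comment> \<open>An index below the degree excludes degree 0, so \<open>m\<close> is the genuine
    last index and the truncated subtraction in \<open>polycyclic_map\<close> does no harm.\<close>
  then obtain m where m: "?n = Suc m" by (cases ?n) auto
  have "(map_vec \<sigma> g \<^sub>v* companion f) $ j = (\<Sum>i<Suc m. \<sigma> (g $ i) * companion f $$ (i, j))"
    using assms j m by (auto intro!: sum.cong)
  also have "\<dots> = (\<Sum>i<m. \<sigma> (g $ i) * (if j = Suc i then 1 else 0)) + \<sigma> (g $ m) * - coeff f j"
    using j m by (auto simp: index_companion intro!: sum.cong)
  also have "(\<Sum>i<m. \<sigma> (g $ i) * (if j = Suc i then 1 else 0)) = shift_vec \<sigma> g $ j"
  proof (cases j)
    \<comment> \<open>No \<open>Suc i\<close> equals 0, so all terms vanish, in agreement with the 0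
      that the shift puts in front.\<close>
    case 0
    then show ?thesis using assms m by (simp add: shift_vec_def)
  next
    case (Suc k)
    have "(\<Sum>i<m. \<sigma> (g $ i) * (if j = Suc i then 1 else 0))
        = (\<Sum>i<m. if k = i then \<sigma> (g $ i) else 0)"
      using Suc by (intro sum.cong) auto
    also have "\<dots> = \<sigma> (g $ k)" using Suc j m by simp
    also have "\<dots> = shift_vec \<sigma> g $ j" using Suc j assms by (simp add: shift_vec_def)
    finally show ?thesis .
  qed
  finally show "polycyclic_map \<sigma> \<delta> f g $ j = (map_vec \<sigma> g \<^sub>v* companion f + map_vec \<delta> g) $ j"
    using assms j m by (simp add: polycyclic_map_def shift_vec_def tail_vec_def)
qed (use assms in \<open>simp add: polycyclic_map_def\<close>)

lemma polycyclic_map_carrier: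
  "g \<in> carrier_vec (degree f) \<Longrightarrow> polycyclic_map \<sigma> \<delta> f g \<in> carrier_vec (degree f)"
  by (auto simp: polycyclic_map_eq intro: carrier_vecI)

lemma polycyclic_map_intertwine:
  fixes \<sigma> \<delta> :: "'a::ring_1 \<Rightarrow> 'a"
  assumes hom: "Ring_Hom.ring_hom \<sigma>" and der: "skew_derivation \<sigma> \<delta>"
    and f: "degree f1 = n" "degree f2 = n"
    and B: "B \<in> carrier_mat n n"
    and eq: "companion f1 * B = map_mat \<sigma> B * companion f2 + map_mat \<delta> B"
    and g: "g \<in> carrier_vec n"
  shows "polycyclic_map \<sigma> \<delta> f1 g \<^sub>v* B = polycyclic_map \<sigma> \<delta> f2 (g \<^sub>v* B)"
proof -
  have C: "companion f1 \<in> carrier_mat n n" "companion f2 \<in> carrier_mat n n"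
    using companion_carrier[of f1] companion_carrier[of f2] f by simp_all
  have "polycyclic_map \<sigma> \<delta> f1 g \<^sub>v* B
      = (map_vec \<sigma> g \<^sub>v* companion f1) \<^sub>v* B + map_vec \<delta> g \<^sub>v* B"
    using g f B C by (simp add: polycyclic_map_eq vec_mat_mult_add_left[of _ n n])
  \<comment> \<open>Associativity brings \<open>companion f1\<close> next to \<open>B\<close>, where
    \<open>eq\<close> rewrites the product into two terms.\<close>
  also have "(map_vec \<sigma> g \<^sub>v* companion f1) \<^sub>v* B
      = (map_vec \<sigma> g \<^sub>v* map_mat \<sigma> B) \<^sub>v* companion f2 + map_vec \<sigma> g \<^sub>v* map_mat \<delta> B"
    using B C by (simp add: vec_mat_mult_assoc[symmetric, of _ n n _ n] eq
        vec_mat_mult_add_right[of _ n n])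
  also have "map_vec \<sigma> g \<^sub>v* map_mat \<sigma> B = map_vec \<sigma> (g \<^sub>v* B)"
    using map_vec_vec_mat_mult_hom[OF hom B g] by simp
  \<comment> \<open>The last two summands on the left are the product rule expansion of
    \<open>map_vec \<delta> (g \<^sub>v* B)\<close>.\<close>
  also have "map_vec \<sigma> (g \<^sub>v* B) \<^sub>v* companion f2 + map_vec \<sigma> g \<^sub>v* map_mat \<delta> B + map_vec \<delta> g \<^sub>v* B
      = map_vec \<sigma> (g \<^sub>v* B) \<^sub>v* companion f2 + map_vec \<delta> (g \<^sub>v* B)"
    using B C g by (simp add: map_vec_vec_mat_mult_skew_derivation[OF der B g]
        assoc_add_vec[of _ n])
  also have "\<dots> = polycyclic_map \<sigma> \<delta> f2 (g \<^sub>v* B)"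
    using B f by (simp add: polycyclic_map_eq)
  finally show ?thesis .
qed

text \<open>Column \<open>j\<close> has a single nonzero entry \<open>b j\<close>, in row
  \<open>p j\<close> and with inverse \<open>c j\<close>, so the sum for coordinate \<open>j\<close>
  collapses to one term. Multiplication by \<open>B\<close> thus becomes a permutation of
  coordinates followed by right multiplication by units.\<close>

lemma monomial_mat_obtains:
  assumes "monomial_mat n B"
  obtains p b c where "bij_betw p {..<n} {..<n}"
    and "\<forall>j<n. b j * c j = 1" and "\<forall>j<n. c j * b j = 1"
    and "\<forall>v. \<forall>j<n. (v \<^sub>v* B) $ j = v $ p j * b j"
proof -
  have B: "B \<in> carrier_mat n n" and row: "\<And>i. i < n \<Longrightarrow> \<exists>!j. j < n \<and> B $$ (i, j) \<noteq> 0"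
    and col: "\<And>j. j < n \<Longrightarrow> \<exists>!i. i < n \<and> B $$ (i, j) \<noteq> 0"
    and unit: "\<And>i j. i < n \<Longrightarrow> j < n \<Longrightarrow> B $$ (i, j) \<noteq> 0 \<Longrightarrow> ring_unit (B $$ (i, j))"
    using assms by (simp_all add: monomial_mat_def)
  define p where "p j = (THE i. i < n \<and> B $$ (i, j) \<noteq> 0)" for j
  have p: "p j < n \<and> B $$ (p j, j) \<noteq> 0" if "j < n" for j
    unfolding p_def by (rule theI'[OF col[OF that]])
  have p_eq: "i = p j" if "i < n" "j < n" "B $$ (i, j) \<noteq> 0" for i j
    using col[OF \<open>j < n\<close>] p[OF \<open>j < n\<close>] that by blast
  \<comment> \<open>Two columns with the same value of \<open>p\<close> would give two nonzero
    entries in one row. Surjectivity then follows from the finiteness of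
    \<open>{..<n}\<close>.\<close>
  have "inj_on p {..<n}"
  proof (rule inj_onI)
    fix j k assume "j \<in> {..<n}" "k \<in> {..<n}" "p j = p k"
    then show "j = k" using p[of j] p[of k] row[of "p j"] by auto
  qed
  moreover have "p ` {..<n} \<subseteq> {..<n}" using p by auto
  ultimately have bij: "bij_betw p {..<n} {..<n}"
    by (simp add: bij_betw_def endo_inj_surj)
  have "\<forall>j<n. \<exists>c. B $$ (p j, j) * c = 1 \<and> c * B $$ (p j, j) = 1"
    using unit p unfolding ring_unit_def by blast
  then obtain c where c: "\<And>j. j < n \<Longrightarrow> B $$ (p j, j) * c j = 1 \<and> c j * B $$ (p j, j) = 1"
    by metis
  have "(v \<^sub>v* B) $ j = v $ p j * B $$ (p j, j)" if j: "j < n" for v j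
  proof -
    have "(v \<^sub>v* B) $ j = (\<Sum>i<n. v $ i * B $$ (i, j))" using B j by simp
    also have "\<dots> = (\<Sum>i\<in>{p j}. v $ i * B $$ (i, j))"
    proof (rule sum.mono_neutral_right)
      have "B $$ (i, j) = 0" if "i < n" "i \<noteq> p j" for i
        using p_eq[OF \<open>i < n\<close> j] that by blast
      then show "\<forall>i\<in>{..<n} - {p j}. v $ i * B $$ (i, j) = 0" by simp
    qed (use p[OF j] in simp_all)
    finally show ?thesis by simp
  qed
  with bij c show thesis by (intro that[of p "\<lambda>j. B $$ (p j, j)" c]) simp_all
qed

lemma monomial_mat_bij:
  assumes "monomial_mat n B"
  shows "bij_betw (\<lambda>v. v \<^sub>v* B) (carrier_vec n) (carrier_vec n)"
proof -
  from assms have B: "B \<in> carrier_mat n n" by (simp add: monomial_mat_def)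
  obtain p b c where p: "bij_betw p {..<n} {..<n}"
    and bc: "\<forall>j<n. b j * c j = 1" and cb: "\<forall>j<n. c j * b j = 1"
    and vB: "\<forall>v. \<forall>j<n. (v \<^sub>v* B) $ j = v $ p j * b j"
    by (rule monomial_mat_obtains[OF assms]) blast
  define q where "q = inv_into {..<n} p"
  have q: "q i < n" "p (q i) = i" if "i < n" for i
    using bij_betw_inv_into[OF p] bij_betw_inv_into_right[OF p] that
    by (auto simp: q_def bij_betw_def)
  have qp: "q (p j) = j" "p j < n" if "j < n" for j
    using p that unfolding q_def by (auto simp: bij_betw_def)
  \<comment> \<open>Solving \<open>w $ j = v $ p j * b j\<close> for \<open>v\<close> at
    \<open>j = q i\<close> gives this inverse. The noncommutative setting makes both identities
    relevant: \<open>bc\<close> cancels in one composition, \<open>cb\<close> in the other.\<close>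
  define \<theta> where "\<theta> w = vec n (\<lambda>i. w $ q i * c (q i))" for w
  show ?thesis
  proof (rule bij_betw_byWitness[where f' = \<theta>])
    show "\<forall>v\<in>carrier_vec n. \<theta> (v \<^sub>v* B) = v"
      using q by (auto simp: \<theta>_def vB mult.assoc bc intro!: eq_vecI)
    show "\<forall>w\<in>carrier_vec n. \<theta> w \<^sub>v* B = w"
      using B qp by (auto simp: \<theta>_def vB mult.assoc cb simp del: index_vec_mat_mult intro!: eq_vecI)
  qed (use B in \<open>auto simp: \<theta>_def\<close>)
qed

lemma hamming_weight_monomial_mat:
  assumes "monomial_mat n B" "v \<in> carrier_vec n"
  shows "hamming_weight (v \<^sub>v* B) = hamming_weight v"
proof -
  from assms have B: "B \<in> carrier_mat n n" by (simp add: monomial_mat_def)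
  obtain p b c where p: "bij_betw p {..<n} {..<n}"
    and bc: "\<forall>j<n. b j * c j = 1"
    and vB: "\<forall>v. \<forall>j<n. (v \<^sub>v* B) $ j = v $ p j * b j"
    by (rule monomial_mat_obtains[OF assms(1)]) blast
  \<comment> \<open>In a ring with zero divisors a factor on the right could annihilate a nonzero
    coordinate; multiplying back by \<open>c j\<close> shows that \<open>b j\<close> does not. Hence
    \<open>p\<close> matches the two supports.\<close>
  have nz: "(v \<^sub>v* B) $ j \<noteq> 0 \<longleftrightarrow> v $ p j \<noteq> 0" if "j < n" for j
  proof -
    have "v $ p j = (v \<^sub>v* B) $ j * c j"
      using that by (simp only: vB mult.assoc bc mult_1_right)
    then show ?thesis using vB that by force
  qed
  have "bij_betw p {j. j < n \<and> (v \<^sub>v* B) $ j \<noteq> 0} {i. i < n \<and> v $ i \<noteq> 0}"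
  proof (rule bij_betw_subset[OF p])
    have "i \<in> p ` {j. j < n \<and> (v \<^sub>v* B) $ j \<noteq> 0}" if "i < n" "v $ i \<noteq> 0" for i
    proof -
      have "i \<in> p ` {..<n}" using p \<open>i < n\<close> by (simp add: bij_betw_def)
      then obtain j where "j < n" "i = p j" by blast
      then show ?thesis using nz that by blast
    qed
    moreover have "p j < n" if "j < n" for j using p that by (auto simp: bij_betw_def)
    ultimately show "p ` {j. j < n \<and> (v \<^sub>v* B) $ j \<noteq> 0} = {i. i < n \<and> v $ i \<noteq> 0}"
      using nz by blast
  qed auto
  then show ?thesis
    using B assms(2) by (simp add: hamming_weight_def bij_betw_same_card del: index_vec_mat_mult)
qed

theorem theorem4:
  fixes \<sigma> \<delta> :: "'a::{finite, ring_1} \<Rightarrow> 'a"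
    and f1 f2 :: "'a poly" and n :: nat and B :: "'a mat"
  assumes "Ring_Hom.ring_hom \<sigma>" and "skew_derivation \<sigma> \<delta>"
    and "degree f1 = n" and "lead_coeff f1 = 1"
    and "degree f2 = n" and "lead_coeff f2 = 1"
    and "monomial_mat n B"
    and "companion f1 * B = map_mat \<sigma> B * companion f2 + map_mat \<delta> B"
  shows "\<exists>\<Phi>. bij_betw \<Phi> (polycyclic_codes \<sigma> \<delta> f1) (polycyclic_codes \<sigma> \<delta> f2) \<and>
    (\<forall>C\<in>polycyclic_codes \<sigma> \<delta> f1. hamming_isom_equiv C (\<Phi> C))"
proof -
  let ?V = "carrier_vec n :: 'a vec set"
  let ?P1 = "polycyclic_codes \<sigma> \<delta> f1" and ?P2 = "polycyclic_codes \<sigma> \<delta> f2"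
  let ?T1 = "polycyclic_map \<sigma> \<delta> f1" and ?T2 = "polycyclic_map \<sigma> \<delta> f2"
  define \<psi> where "\<psi> v = v \<^sub>v* B" for v
  have B: "B \<in> carrier_mat n n" using assms(7) by (simp add: monomial_mat_def)
  have bij: "bij_betw \<psi> ?V ?V"
    using monomial_mat_bij[OF assms(7)] by (simp add: \<psi>_def[abs_def])
  have \<psi>_carrier: "\<psi> v \<in> ?V" for v using B by (simp add: \<psi>_def)
  have add: "\<psi> (u + v) = \<psi> u + \<psi> v" if "u \<in> ?V" "v \<in> ?V" for u v
    using vec_mat_mult_add_left[OF B that] by (simp add: \<psi>_def)
  have smult: "\<psi> (a \<cdot>\<^sub>v v) = a \<cdot>\<^sub>v \<psi> v" if "v \<in> ?V" for a v
    using vec_mat_mult_smult[OF B that] by (simp add: \<psi>_def)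
  have zero: "\<psi> (0\<^sub>v n) = 0\<^sub>v n" using vec_mat_mult_zero[OF B] by (simp add: \<psi>_def)
  have T: "\<psi> (?T1 v) = ?T2 (\<psi> v)" if "v \<in> ?V" for v
    using polycyclic_map_intertwine[OF assms(1,2,3,5) B assms(8) that] by (simp add: \<psi>_def)
  have T1_carrier: "?T1 v \<in> ?V" if "v \<in> ?V" for v
    using polycyclic_map_carrier[of v f1] that assms(3) by simp
  have sub: "C \<subseteq> ?V" if "C \<in> ?P1 \<or> C \<in> ?P2" for C
    using that assms(3,5) by (auto simp: polycyclic_codes_def left_submodule_def)
  \<comment> \<open>Closure is checked by pulling each operation on images back through \<psi>,
    using linearity and \<open>T\<close> from right to left, and carrying it out inside
    \<open>C\<close>.\<close>
  have image: "\<psi> ` C \<in> ?P2" if C: "C \<in> ?P1" for C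
  proof -
    from C have "0\<^sub>v n \<in> C" "\<And>u v. u \<in> C \<Longrightarrow> v \<in> C \<Longrightarrow> u + v \<in> C"
      "\<And>a v. v \<in> C \<Longrightarrow> a \<cdot>\<^sub>v v \<in> C" "\<And>v. v \<in> C \<Longrightarrow> ?T1 v \<in> C"
      using assms(3) by (auto simp: polycyclic_codes_def left_submodule_def)
    moreover have "v \<in> ?V" if "v \<in> C" for v using sub C that by blast
    ultimately show ?thesis
      unfolding polycyclic_codes_def left_submodule_def assms(5)
      using \<psi>_carrier zero
      by (auto simp: add[symmetric] smult[symmetric] T[symmetric] intro: rev_image_eqI[of "0\<^sub>v n"])
  qed
  \<comment> \<open>Taking preimages as the backward map lets \<open>T\<close> serve here as well,
    with no intertwining relation for the inverse of \<psi>.\<close>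
  have preimage: "{v \<in> ?V. \<psi> v \<in> D} \<in> ?P1" if D: "D \<in> ?P2" for D
    using D unfolding polycyclic_codes_def left_submodule_def assms(3,5)
    by (auto simp: zero add smult T T1_carrier)
  have "bij_betw (\<lambda>C. \<psi> ` C) ?P1 ?P2"
  \<comment> \<open>Injectivity of \<psi> on the whole space gives the first composition,
    surjectivity the second. Both need \<open>sub\<close>, since \<psi> is bijective only between
    vectors of length \<open>n\<close>.\<close>
  proof (rule bij_betw_byWitness[where f' = "\<lambda>D. {v \<in> ?V. \<psi> v \<in> D}"])
    show "\<forall>C\<in>?P1. {v \<in> ?V. \<psi> v \<in> \<psi> ` C} = C"
    proof
      fix C assume "C \<in> ?P1"
      then show "{v \<in> ?V. \<psi> v \<in> \<psi> ` C} = C"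
        using sub[of C] inj_on_image_mem_iff[OF bij_betw_imp_inj_on[OF bij], of _ C] by blast
    qed
    show "\<forall>D\<in>?P2. \<psi> ` {v \<in> ?V. \<psi> v \<in> D} = D"
    proof
      fix D assume "D \<in> ?P2"
      then have "D \<subseteq> \<psi> ` ?V" using sub[of D] bij by (simp add: bij_betw_def)
      then show "\<psi> ` {v \<in> ?V. \<psi> v \<in> D} = D" by blast
    qed
  qed (use image preimage in auto)
  \<comment> \<open>The restriction of the one global map \<psi> is the isometry for every
    code.\<close>
  moreover have "hamming_isom_equiv C (\<psi> ` C)" if C: "C \<in> ?P1" for C
    unfolding hamming_isom_equiv_def
  proof (intro exI[of _ \<psi>] conjI ballI allI)
    show "bij_betw \<psi> C (\<psi> ` C)"
      using bij_betw_subset[OF bij] sub C by blast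
    show "hamming_weight (\<psi> v) = hamming_weight v" if "v \<in> C" for v
      using hamming_weight_monomial_mat[OF assms(7)] sub C that unfolding \<psi>_def by blast
    show "\<psi> (u + v) = \<psi> u + \<psi> v" if "u \<in> C" "v \<in> C" for u v
      using add[of u v] sub C that by blast
    show "\<psi> (a \<cdot>\<^sub>v v) = a \<cdot>\<^sub>v \<psi> v" if "v \<in> C" for a v
      using smult[of v a] sub C that by blast
  qed
  ultimately show ?thesis by blast
qed

end
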